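(* Let $r\ge 2$ be an integer and consider the Ising model on $\mathbb{F}_r$ with interaction strength $J>0$ and zero external field. If either $$J\ \ge\ 2J_{uniq}(r)=2\operatorname{arctanh}\frac1{2r-1}=\log\frac{r}{r-1}$$ or $$J\ \ge\ J_{rec}(r)=\operatorname{arctanh}\big[(2r-1)^{-1/2}\big],$$ then for every sofic approximation $\Sigma$ to $\mathbb{F}_r$ the free boundary state $\mu^{\mathrm{FB}}$ is not $\Sigma$-equilibrium.
   Context: Let $\mathbb{F}_r=\langle s_1,\dots,s_r\rangle$ be the free group of rank $r$; its Cayley graph (edges $\{\gamma,s_i\gamma\}$) is the $2r$-regular tree. $\mathbb{F}_r$ acts on $\{-1,+1\}^{\mathbb{F}_r}$ by the shift $(g\cdot \mathbf{x})(h)=\mathbf{x}(hg)$. Ising model with interaction strength $J>0$ and no external field: $u(\mathbf{x})=-\frac{J}{2}\sum_{i=1}^r\big(\mathbf{x}(e)\mathbf{x}(s_i)+\mathbf{x}(e)\mathbf{x}(s_i^{-1})\big)$, and $u(\mu)=\int u\,d\mu$. Low temperature means large $J$ (temperature is $1/J$). The free boundary state $\mu^{\mathrm{FB}}$ is the tree-indexed Markov chain on $\{-1,+1\}^{\mathbb{F}_r}$, invariant under all automorphisms of the Cayley tree, with uniform single-site marginals and with transition probabilities across each edge $\mathbb{P}\{-1\to+1\}=\mathbb{P}\{+1\to-1\}=\frac1{e^{2J}+1}$ and $\mathbb{P}\{-1\to-1\}=\mathbb{P}\{+1\to+1\}=\frac{e^{2J}}{e^{2J}+1}$. For a finite set $V$,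 a map $\sigma:\mathbb{F}_r\to\operatorname{Sym}(V)$ and $\mathbf{x}\in\{-1,+1\}^V$, let $\Pi_v^\sigma\mathbf{x}(\gamma)=\mathbf{x}(\sigma(\gamma)(v))$ and $P^\sigma_{\mathbf{x}}=\frac1{|V|}\sum_{v\in V}\delta_{\Pi_v^\sigma\mathbf{x}}$. For a set $\mathcal{O}$ of Borel probability measures on $\{-1,+1\}^{\mathbb{F}_r}$ let $\Omega(\sigma,\mathcal{O})=\{\mathbf{x}: P^\sigma_{\mathbf{x}}\in\mathcal{O}\}$. For finite $F\subset\mathbb{F}_r$ and $\delta>0$, $\sigma$ is $(F,\delta)$-sofic if $\frac1{|V|}|\{v:\sigma(\gamma)(v)\ne v\ \forall\gamma\in F\setminus\{e\}\}|>1-\delta$ and $\frac1{|V|}|\{v:\sigma(\gamma_1\gamma_2)(v)=\sigma(\gamma_1)(\sigma(\gamma_2)(v))\ \forall\gamma_1,\gamma_2\in F\}|>1-\delta$. A sequence $\Sigma=\{\sigma_n:\mathbb{F}_r\to\operatorname{Sym}(V_n)\}$ is a sofic approximation if $|V_n|\to\infty$ and for all $F,\delta$ the map $\sigma_n$ is $(F,\delta)$-sofic for all large $n$. Sofic entropy: $\mathrm{h}_\Sigma(\mu)=\inf_{\mathcal{O}\ni\mu}\limsup_{n\to\infty}\frac1{|V_n|}\log|\Omega(\sigma_n,\mathcal{O})|$, with $\mathcal{O}$ ranging over weak*-open neighborhoods of $\mu$. Pressure: $\mathrm{p}_\Sigma(\mu)=\mathrm{h}_\Sigma(\mu)-u(\mu)$.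 A shift-invariant $\mu$ is $\Sigma$-equilibrium if it maximizes $\mathrm{p}_\Sigma$ over all shift-invariant Borel probability measures on $\{-1,+1\}^{\mathbb{F}_r}$. *)

theory Defs
  imports "HOL-Probability.Probability"
begin

text \<open>
  The free group of rank \<open>r\<close> is the type \<open>'s free_group\<close> of reduced words, where the index
  type \<open>'s\<close> of the free generators has \<open>r\<close> elements. A letter \<open>(i, True)\<close> stands for
  \<open>s\<^sub>i\<close> and \<open>(i, False)\<close> for its inverse.
\<close>

definition inv_letter :: "'s \<times> bool \<Rightarrow> 's \<times> bool" where
  "inv_letter a = (fst a, \<not> snd a)"

definition reduced_word :: "('s \<times> bool) list \<Rightarrow> bool" where
  "reduced_word = successively (\<lambda>a b. b \<noteq> inv_letter a)"

definition mult_letter :: "'s \<times> bool \<Rightarrow> ('s \<times> bool) list \<Rightarrow> ('s \<times> bool) list" where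
  "mult_letter a w = (if w \<noteq> [] \<and> hd w = inv_letter a then tl w else a # w)"

definition mult_word :: "('s \<times> bool) list \<Rightarrow> ('s \<times> bool) list \<Rightarrow> ('s \<times> bool) list" where
  "mult_word = foldr mult_letter"

definition inv_word :: "('s \<times> bool) list \<Rightarrow> ('s \<times> bool) list" where
  "inv_word w = rev (map inv_letter w)"

lemma inv_letter_inv_letter [simp]: "inv_letter (inv_letter a) = a"
  by (simp add: inv_letter_def)

lemma reduced_word_Nil [simp]: "reduced_word []"
  by (simp add: reduced_word_def)

lemma reduced_word_Cons:
  "reduced_word (a # w) \<longleftrightarrow> reduced_word w \<and> (w \<noteq> [] \<longrightarrow> hd w \<noteq> inv_letter a)"
  by (auto simp: reduced_word_def successively_Cons)

lemma reduced_mult_letter: "reduced_word w \<Longrightarrow> reduced_word (mult_letter a w)"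
  by (cases w) (auto simp: mult_letter_def reduced_word_Cons)

lemma mult_letter_cancel: "reduced_word w \<Longrightarrow> mult_letter a (mult_letter (inv_letter a) w) = w"
  by (cases w; cases "tl w") (auto simp: mult_letter_def reduced_word_Cons)

lemma mult_word_Nil [simp]: "mult_word [] w = w"
  by (simp add: mult_word_def)

lemma mult_word_Cons: "mult_word (a # u) w = mult_letter a (mult_word u w)"
  by (simp add: mult_word_def)

lemma reduced_mult_word: "reduced_word w \<Longrightarrow> reduced_word (mult_word u w)"
  by (induction u) (auto simp: mult_word_Cons reduced_mult_letter)

lemma mult_word_mult_letter:
  assumes "reduced_word w"
  shows "mult_word (mult_letter a u) w = mult_letter a (mult_word u w)"
proof (cases "u \<noteq> [] \<and> hd u = inv_letter a")
  case True
  then obtain u' where u: "u = inv_letter a # u'"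
    by (cases u) auto
  then show ?thesis
    using reduced_mult_word[OF assms]
    by (simp add: mult_word_Cons mult_letter_cancel) (simp add: mult_letter_def)
next
  case False
  then have "mult_letter a u = a # u"
    by (auto simp: mult_letter_def)
  then show ?thesis
    by (simp add: mult_word_Cons)
qed

lemma mult_word_assoc:
  "reduced_word w \<Longrightarrow> mult_word (mult_word u v) w = mult_word u (mult_word v w)"
  by (induction u) (auto simp: mult_word_Cons mult_word_mult_letter)

lemma mult_word_Nil_right: "reduced_word u \<Longrightarrow> mult_word u [] = u"
  by (induction u) (auto simp: mult_word_Cons mult_letter_def reduced_word_Cons)

lemma reduced_inv_word: "reduced_word u \<Longrightarrow> reduced_word (inv_word u)"
  by (auto simp: inv_word_def reduced_word_def successively_map successively_rev
      elim!: successively_mono)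

lemma mult_inv_word_left: "mult_word (inv_word u) u = []"
proof (induction u)
  case (Cons a u)
  have "mult_word (inv_word (a # u)) (a # u) =
      mult_word (inv_word u) (mult_letter (inv_letter a) (a # u))"
    by (simp add: inv_word_def mult_word_def)
  also have "mult_letter (inv_letter a) (a # u) = u"
    by (simp add: mult_letter_def)
  finally show ?case
    using Cons.IH by simp
qed (simp add: inv_word_def)

typedef 's free_group = "{w :: ('s \<times> bool) list. reduced_word w}"
  morphisms word_of Free_Group
  by (rule exI[of _ "[]"]) simp

setup_lifting type_definition_free_group

instantiation free_group :: (type) monoid_mult
begin

lift_definition one_free_group :: "'s free_group" is "[]"
  by simp

lift_definition times_free_group :: "'s free_group \<Rightarrow> 's free_group \<Rightarrow> 's free_group"
  is mult_word
  by (rule reduced_mult_word)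

instance
  by standard (transfer; simp add: mult_word_assoc mult_word_Nil_right)+

end

instantiation free_group :: (type) inverse
begin

lift_definition inverse_free_group :: "'s free_group \<Rightarrow> 's free_group" is inv_word
  by (rule reduced_inv_word)

definition divide_free_group :: "'s free_group \<Rightarrow> 's free_group \<Rightarrow> 's free_group" where
  "divide_free_group g h = g * inverse h"

instance ..

end

lemma free_group_left_inverse: "inverse g * g = (1 :: 's free_group)"
  by transfer (rule mult_inv_word_left)

lift_definition gen :: "'s \<Rightarrow> 's free_group" is "\<lambda>i. [(i, True)]"
  by (simp add: reduced_word_def)

text \<open>The Cayley graph has the edges \<open>{g, s\<^sub>i g}\<close>.\<close>

definition cayley_adj :: "'s free_group \<Rightarrow> 's free_group \<Rightarrow> bool" where
  "cayley_adj g h \<longleftrightarrow> (\<exists>i. h = gen i * g \<or> g = gen i * h)"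

definition cayley_dist :: "'s free_group \<Rightarrow> 's free_group \<Rightarrow> nat" where
  "cayley_dist g h = (LEAST n. (cayley_adj ^^ n) g h)"

definition cayley_automorphism :: "('s free_group \<Rightarrow> 's free_group) \<Rightarrow> bool" where
  "cayley_automorphism \<phi> \<longleftrightarrow>
     bij \<phi> \<and> (\<forall>g h. cayley_adj (\<phi> g) (\<phi> h) \<longleftrightarrow> cayley_adj g h)"

text \<open>
  The spin space \<open>{-1, +1}\<close> is represented by \<open>bool\<close>, which carries the discrete topology;
  \<open>spin_value\<close> gives the numerical value of a spin. Accordingly \<open>'s config\<close> carries the
  product topology, and \<open>borel\<close> is its Borel sigma-algebra.
\<close>

definition spin_value :: "bool \<Rightarrow> real" where
  "spin_value a = (if a then 1 else - 1)"

type_synonym 's config = "'s free_group \<Rightarrow> bool"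

definition borel_probs :: "'s config measure set" where
  "borel_probs = {\<mu>. prob_space \<mu> \<and> sets \<mu> = sets borel}"

definition weak_star :: "'s config measure topology" where
  "weak_star = topology_generated_by
     {{\<mu> \<in> borel_probs. (\<integral>x. f x \<partial>\<mu>) \<in> U} | f U. continuous_on UNIV f \<and> open (U :: real set)}"

definition shift :: "'s free_group \<Rightarrow> 's config \<Rightarrow> 's config" where
  "shift g x = (\<lambda>h. x (h * g))"

definition shift_invariant :: "'s config measure \<Rightarrow> bool" where
  "shift_invariant \<mu> \<longleftrightarrow> (\<forall>g. distr \<mu> borel (shift g) = \<mu>)"

definition ising_energy :: "real \<Rightarrow> 's::finite config \<Rightarrow> real" where
  "ising_energy J x = - (J / 2) *
     (\<Sum>i\<in>UNIV. spin_value (x 1) * spin_value (x (gen i))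
             + spin_value (x 1) * spin_value (x (inverse (gen i))))"

definition mean_energy :: "real \<Rightarrow> 's::finite config measure \<Rightarrow> real" where
  "mean_energy J \<mu> = (\<integral>x. ising_energy J x \<partial>\<mu>)"

text \<open>
  The past of the oriented edge from \<open>v\<close> to \<open>w\<close> consists of the vertices on the side of \<open>v\<close>,
  i.e. the component containing \<open>v\<close> after deletion of that edge.
\<close>

definition edge_past :: "'s free_group \<Rightarrow> 's free_group \<Rightarrow> 's free_group set" where
  "edge_past v w = {u. cayley_dist u w = cayley_dist u v + 1}"

text \<open>
  Markov property of a random field indexed by the Cayley tree: across every oriented edge
  from \<open>v\<close> to \<open>w\<close>, the spin at \<open>w\<close> depends on the past only through the spin at \<open>v\<close>. As the
  spin space is finite, conditioning on finitely many vertices of the past suffices.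
\<close>

definition tree_markov_chain :: "'s config measure \<Rightarrow> bool" where
  "tree_markov_chain \<mu> \<longleftrightarrow>
     (\<forall>v w A \<xi> b. cayley_adj v w \<longrightarrow> finite A \<longrightarrow> v \<in> A \<longrightarrow> A \<subseteq> edge_past v w \<longrightarrow>
        \<P>(x in \<mu>. \<forall>u\<in>A. x u = \<xi> u) \<noteq> 0 \<longrightarrow>
        \<P>(x in \<mu>. x w = b \<bar> \<forall>u\<in>A. x u = \<xi> u) = \<P>(x in \<mu>. x w = b \<bar> x v = \<xi> v))"

definition ising_transition :: "real \<Rightarrow> bool \<Rightarrow> bool \<Rightarrow> real" where
  "ising_transition J a b =
     (if a = b then exp (2 * J) / (exp (2 * J) + 1) else 1 / (exp (2 * J) + 1))"

text \<open>These conditions determine the finite-dimensional marginals, hence the measure.\<close>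

definition free_boundary_state :: "real \<Rightarrow> 's config measure \<Rightarrow> bool" where
  "free_boundary_state J \<mu> \<longleftrightarrow>
     \<mu> \<in> borel_probs \<and>
     tree_markov_chain \<mu> \<and>
     (\<forall>\<phi>. cayley_automorphism \<phi> \<longrightarrow> distr \<mu> borel (\<lambda>x. x \<circ> \<phi>) = \<mu>) \<and>
     (\<forall>v a. \<P>(x in \<mu>. x v = a) = 1 / 2) \<and>
     (\<forall>v w a b. cayley_adj v w \<longrightarrow> \<P>(x in \<mu>. x w = b \<bar> x v = a) = ising_transition J a b)"

definition pullback :: "('s free_group \<Rightarrow> 'v \<Rightarrow> 'v) \<Rightarrow> 'v \<Rightarrow> ('v \<Rightarrow> bool) \<Rightarrow> 's config" where
  "pullback \<sigma> v x = (\<lambda>g. x (\<sigma> g v))"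

text \<open>
  The image of the uniform distribution on \<open>V\<close>, that is, the average of the Dirac measures at
  the pullbacks (see \<open>emeasure_empirical_distribution\<close>).
\<close>

definition empirical_distribution ::
    "'v set \<Rightarrow> ('s free_group \<Rightarrow> 'v \<Rightarrow> 'v) \<Rightarrow> ('v \<Rightarrow> bool) \<Rightarrow> 's config measure" where
  "empirical_distribution V \<sigma> x =
     distr (uniform_count_measure V) borel (\<lambda>v. pullback \<sigma> v x)"

text \<open>Labellings of \<open>V\<close> are functions that are \<open>undefined\<close> outside \<open>V\<close>, so each counts once.\<close>

definition good_models ::
    "'v set \<Rightarrow> ('s free_group \<Rightarrow> 'v \<Rightarrow> 'v) \<Rightarrow> 's config measure set \<Rightarrow> ('v \<Rightarrow> bool) set" where
  "good_models V \<sigma> \<O> = {x \<in> V \<rightarrow>\<^sub>E UNIV. empirical_distribution V \<sigma> x \<in> \<O>}"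

definition sofic_map ::
    "'v set \<Rightarrow> ('s free_group \<Rightarrow> 'v \<Rightarrow> 'v) \<Rightarrow> 's free_group set \<Rightarrow> real \<Rightarrow> bool" where
  "sofic_map V \<sigma> F \<delta> \<longleftrightarrow>
     real (card {v \<in> V. \<forall>g\<in>F - {1}. \<sigma> g v \<noteq> v}) / real (card V) > 1 - \<delta> \<and>
     real (card {v \<in> V. \<forall>g\<in>F. \<forall>h\<in>F. \<sigma> (g * h) v = \<sigma> g (\<sigma> h v)}) / real (card V) > 1 - \<delta>"

definition sofic_approximation ::
    "(nat \<Rightarrow> 'v set) \<Rightarrow> (nat \<Rightarrow> 's free_group \<Rightarrow> 'v \<Rightarrow> 'v) \<Rightarrow> bool" where
  "sofic_approximation V \<sigma> \<longleftrightarrow>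
     (\<forall>n. finite (V n)) \<and> (\<forall>n g. \<sigma> n g permutes V n) \<and>
     filterlim (\<lambda>n. card (V n)) at_top sequentially \<and>
     (\<forall>F \<delta>. finite F \<longrightarrow> \<delta> > 0 \<longrightarrow> (\<forall>\<^sub>F n in sequentially. sofic_map (V n) (\<sigma> n) F \<delta>))"

definition log_card :: "'a set \<Rightarrow> ereal" where
  "log_card A = (if card A = 0 then - \<infinity> else ereal (ln (real (card A))))"

definition sofic_entropy ::
    "(nat \<Rightarrow> 'v set) \<Rightarrow> (nat \<Rightarrow> 's free_group \<Rightarrow> 'v \<Rightarrow> 'v) \<Rightarrow> 's config measure \<Rightarrow> ereal" where
  "sofic_entropy V \<sigma> \<mu> =
     (INF \<O>\<in>{\<O>. openin weak_star \<O> \<and> \<mu> \<in> \<O>}.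
        limsup (\<lambda>n. ereal (1 / real (card (V n))) * log_card (good_models (V n) (\<sigma> n) \<O>)))"

definition pressure ::
    "(nat \<Rightarrow> 'v set) \<Rightarrow> (nat \<Rightarrow> 's::finite free_group \<Rightarrow> 'v \<Rightarrow> 'v) \<Rightarrow> real \<Rightarrow>
     's config measure \<Rightarrow> ereal" where
  "pressure V \<sigma> J \<mu> = sofic_entropy V \<sigma> \<mu> - ereal (mean_energy J \<mu>)"

definition equilibrium ::
    "(nat \<Rightarrow> 'v set) \<Rightarrow> (nat \<Rightarrow> 's::finite free_group \<Rightarrow> 'v \<Rightarrow> 'v) \<Rightarrow> real \<Rightarrow>
     's config measure \<Rightarrow> bool" where
  "equilibrium V \<sigma> J \<mu> \<longleftrightarrow>
     \<mu> \<in> borel_probs \<and> shift_invariant \<mu> \<and>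
     (\<forall>\<nu>\<in>borel_probs. shift_invariant \<nu> \<longrightarrow> pressure V \<sigma> J \<nu> \<le> pressure V \<sigma> J \<mu>)"

definition J_uniq :: "nat \<Rightarrow> real" where
  "J_uniq r = artanh (1 / (2 * real r - 1))"

definition J_rec :: "nat \<Rightarrow> real" where
  "J_rec r = artanh ((2 * real r - 1) powr (- 1 / 2))"

lemma two_J_uniq_eq:
  assumes "r \<ge> 2"
  shows "2 * J_uniq r = ln (real r / (real r - 1))"
proof -
  have "(1 + 1 / (2 * real r - 1)) / (1 - 1 / (2 * real r - 1)) = real r / (real r - 1)"
    using assms by (simp add: divide_simps)
  then show ?thesis
    by (simp add: J_uniq_def artanh_def)
qed

lemma measurable_reindex:
  "(\<lambda>x. x \<circ> \<phi>) \<in> borel_measurable (borel :: 's config measure)"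
  by (intro borel_measurable_continuous_onI continuous_on_coordinatewise_then_product)
    (auto simp: o_def intro!: continuous_on_product_coordinates)

lemma measurable_shift: "shift g \<in> borel_measurable borel"
  using measurable_reindex[of "\<lambda>h. h * g"] by (simp add: shift_def[abs_def] o_def)

lemma cylinder_borel: "{x :: 's config. x w = b} \<in> sets borel"
proof -
  have "open ((\<lambda>x :: 's config. x w) -` {b})"
    by (intro open_vimage continuous_on_product_coordinates) (rule Topological_Spaces.open_discrete)
  then show ?thesis
    by (simp add: vimage_def)
qed

lemma empirical_distribution_borel_probs:
  assumes "finite V" "V \<noteq> {}"
  shows "empirical_distribution V \<sigma> x \<in> borel_probs"
proof -
  have "prob_space (distr (uniform_count_measure V) borel (\<lambda>v. pullback \<sigma> v x))"
    using assms by (intro prob_space.prob_space_distr prob_space_uniform_count_measure)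
      (simp_all add: measurable_def space_uniform_count_measure sets_uniform_count_measure)
  then show ?thesis
    by (simp add: borel_probs_def empirical_distribution_def)
qed

lemma emeasure_empirical_distribution:
  assumes "finite V" "V \<noteq> {}" "A \<in> sets borel"
  shows "emeasure (empirical_distribution V \<sigma> x) A =
    ennreal ((\<Sum>v\<in>V. measure (return borel (pullback \<sigma> v x)) A) / real (card V))"
proof -
  let ?B = "(\<lambda>v. pullback \<sigma> v x) -` A \<inter> V"
  have "emeasure (empirical_distribution V \<sigma> x) A = emeasure (uniform_count_measure V) ?B"
    using assms by (simp add: empirical_distribution_def emeasure_distr
        measurable_def space_uniform_count_measure sets_uniform_count_measure)
  also have "\<dots> = ennreal (real (card ?B) / real (card V))"
    using assms by (subst emeasure_uniform_count_measure) auto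
  also have "real (card ?B) = (\<Sum>v\<in>V. measure (return borel (pullback \<sigma> v x)) A)"
    using assms by (simp add: measure_return indicator_def sum.If_cases vimage_def Int_def conj_commute)
  finally show ?thesis .
qed

end

theory Submission
  imports Defs "HOL-Combinatorics.Orbits"
begin

text \<open>
  The pressure of the free boundary state is strictly smaller than that of the point mass at the
  all-plus configuration. That point mass has sofic entropy at least 0, since constant labellings
  are perfect models of it (\<open>sofic_entropy_plus_state_nonneg\<close>), and mean energy \<open>- J r\<close>, so its
  pressure is at least \<open>J r\<close>.

  For the free boundary state let \<open>p = 1 / (e\<^sup>2\<^sup>J + 1)\<close> be the probability that the two ends of an edge
  disagree. Its mean energy is \<open>- J r (1 - 2 p)\<close>. Its sofic entropy is at most the Shannon entropy
  \<open>2 J p + ln (1 + e\<^sup>-\<^sup>2\<^sup>J)\<close> of a spin with bias \<open>p\<close>, for every sofic approximation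
  (\<open>sofic_entropy_le\<close>). To see this, restrict attention to a single generator \<open>s\<close>. The permutation
  by which \<open>s\<close> acts on the \<open>n\<close> points of a sofic map has only \<open>o(n)\<close> cycles, because short cycles
  contradict soficity. A labelling is determined by its values at one point of each cycle and by
  the set of points where it changes along the permutation. For a good model this set has at most
  \<open>(p + o(1)) n\<close> elements, and an exponential Chebyshev bound counts such sets
  (\<open>card_labellings_le\<close>).

  It remains to check \<open>2 J p + ln (1 + e\<^sup>-\<^sup>2\<^sup>J) + J r (1 - 2 p) < J r\<close>, which for \<open>a = e\<^sup>2\<^sup>J\<close> reads
  \<open>(a + 1) ln (1 + 1/a) < (r - 1) ln a\<close> (\<open>energy_entropy_inequality\<close>). The left-hand side decreases
  in \<open>a\<close> and is therefore smaller than \<open>2 ln 2\<close>, its value at \<open>a = 1\<close>. Both temperature thresholds give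
  \<open>a \<ge> (r/(r-1))\<^sup>2\<close>, and then the right-hand side is at least \<open>2 ln 2\<close> by Bernoulli's inequality.
  The only exception is the threshold \<open>J_rec\<close> in rank 2, which is slightly smaller; there
  \<open>a \<ge> 7/2\<close> and the inequality is numerical.
\<close>

section \<open>Labellings with few disagreements along a permutation\<close>

text \<open>
  A set of representatives of the orbits is small apart from the points on cycles shorter than \<open>L\<close>:
  the first \<open>L\<close> points on the orbits of the other representatives are distinct.
\<close>

lemma orbit_representatives:
  fixes f :: "'v \<Rightarrow> 'v"
  assumes "finite V" "f permutes V"
  obtains R where "R \<subseteq> V" "\<And>v. v \<in> V \<Longrightarrow> \<exists>u\<in>R. \<exists>k. (f ^^ k) u = v"
    "L * card (R - {v \<in> V. \<exists>k\<in>{1..<L}. (f ^^ k) v = v}) \<le> card V"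
proof
  have perm: "permutation f"
    using assms unfolding permutation_permutes by blast
  define rep where "rep v = (SOME u. u \<in> orbit f v)" for v
  define R where "R = rep ` V"
  let ?B = "{v \<in> V. \<exists>k\<in>{1..<L}. (f ^^ k) v = v}"
  have rep: "rep v \<in> orbit f v" for v
    unfolding rep_def using orbit_nonempty[of f v] by (simp add: some_in_eq)
  have orbit_eq: "orbit f ((f ^^ k) v) = orbit f v" for k v
    by (induction k) (simp_all add: permutation_orbit_step[OF perm])
  have orbit_rep: "orbit f (rep v) = orbit f v" for v
  proof -
    obtain k where "rep v = (f ^^ k) v"
      using rep[of v] by (auto simp: orbit_altdef)
    then show ?thesis
      by (simp add: orbit_eq)
  qed
  have rep_cong: "rep u = rep v" if "orbit f u = orbit f v" for u v
    using that by (simp add: rep_def)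
  have rep_R: "rep u = u" if "u \<in> R" for u
    using that rep_cong[OF orbit_rep] by (auto simp: R_def)
  have pow_V: "(f ^^ k) v \<in> V" if "v \<in> V" for k v
    using that by (induction k) (simp_all add: permutes_in_image[OF assms(2)])
  show RV: "R \<subseteq> V"
  proof (unfold R_def, rule image_subsetI)
    fix v assume "v \<in> V"
    then show "rep v \<in> V"
      using rep[of v] pow_V by (auto simp: orbit_altdef)
  qed
  show "\<exists>u\<in>R. \<exists>k. (f ^^ k) u = v" if "v \<in> V" for v
  proof -
    have "v \<in> orbit f (rep v)"
      using permutation_self_in_orbit[OF perm, of v] orbit_rep[of v] by simp
    then obtain k where k: "v = (f ^^ k) (rep v)"
      by (auto simp: orbit_altdef)
    show ?thesis
      by (intro bexI[of _ "rep v"] exI[of _ k] k[symmetric]) (use that in \<open>simp add: R_def\<close>)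
  qed
  have inj: "inj_on (\<lambda>(u, k). (f ^^ k) u) ((R - ?B) \<times> {..<L})"
  proof -
    have key: "u = u' \<and> k = l"
      if "u \<in> R - ?B" "u' \<in> R" "l < L" "k \<le> l" "(f ^^ k) u' = (f ^^ l) u" for u u' k l
    proof -
      have "orbit f u = orbit f u'"
        by (rule box_equals[OF arg_cong[OF that(5)[symmetric], of "orbit f"] orbit_eq orbit_eq])
      then have "rep u = rep u'"
        by (rule rep_cong)
      moreover have "u \<in> R" and *: "\<not> (\<exists>k\<in>{1..<L}. (f ^^ k) u = u)"
        using that(1) RV by blast+
      ultimately have eq: "u' = u"
        using rep_R[of u] rep_R[OF that(2)] by argo
      have "(f ^^ k) ((f ^^ (l - k)) u) = (f ^^ (k + (l - k))) u"
        by (simp only: funpow_add comp_apply)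
      also have "\<dots> = (f ^^ k) u"
        using that(4) by (simp add: that(5)[symmetric, unfolded eq])
      finally have "(f ^^ (l - k)) u = u"
        by (rule injD[OF inj_fn[OF permutes_inj[OF assms(2)]]])
      then have "l - k = 0"
      proof (rule contrapos_pp)
        assume "l - k \<noteq> 0"
        then have "l - k \<in> {1..<L}"
          using that(3) by auto
        then show "(f ^^ (l - k)) u \<noteq> u"
          using * by blast
      qed
      then show ?thesis
        using \<open>k \<le> l\<close> eq by simp
    qed
    show ?thesis
    proof (rule inj_onI)
      fix p q
      assume p: "p \<in> (R - ?B) \<times> {..<L}" and q: "q \<in> (R - ?B) \<times> {..<L}"
        and eq: "(case p of (u, k) \<Rightarrow> (f ^^ k) u) = (case q of (u, k) \<Rightarrow> (f ^^ k) u)"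
      obtain u k u' l where pq: "p = (u, k)" "q = (u', l)"
        by (metis surj_pair)
      have u: "u \<in> R - ?B" "k < L" and u': "u' \<in> R - ?B" "l < L"
        using p q unfolding pq by blast+
      have eq': "(f ^^ k) u = (f ^^ l) u'"
        using eq unfolding pq prod.case .
      show "p = q"
      proof (cases "k \<le> l")
        case True
        then show ?thesis
          using key[OF u'(1) DiffD1[OF u(1)] u'(2) True eq'] by (simp add: pq)
      next
        case False
        then have "l \<le> k"
          by simp
        then show ?thesis
          using key[OF u(1) DiffD1[OF u'(1)] u(2) _ eq'[symmetric]] by (simp add: pq)
      qed
    qed
  qed
  have "card ((R - ?B) \<times> {..<L}) \<le> card V"
    by (rule card_inj_on_le[OF inj _ assms(1)]) (use RV pow_V in auto)
  then show "L * card (R - ?B) \<le> card V"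
    by (simp add: card_cartesian_product mult.commute)
qed

text \<open>
  An exponential Chebyshev bound: each set counted has weight \<open>exp (t * (c - card D)) \<ge> 1\<close>, and the
  weights of all subsets add up to the right-hand side.
\<close>

lemma card_small_subsets_le:
  fixes c t :: real
  assumes "finite V" "t \<ge> 0"
  shows "real (card {D \<in> Pow V. real (card D) \<le> c}) \<le> exp (t * c) * (1 + exp (- t)) ^ card V"
proof -
  have "real (card {D \<in> Pow V. real (card D) \<le> c}) = (\<Sum>D | D \<in> Pow V \<and> real (card D) \<le> c. 1)"
    by simp
  also have "\<dots> \<le> (\<Sum>D | D \<in> Pow V \<and> real (card D) \<le> c. exp (t * c) * exp (- t) ^ card D)"
  proof (rule sum_mono)
    fix D assume "D \<in> {D. D \<in> Pow V \<and> real (card D) \<le> c}"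
    then have "0 \<le> t * (c - real (card D))"
      using assms(2) by simp
    then have "1 \<le> exp (t * (c - real (card D)))"
      by simp
    also have "\<dots> = exp (t * c) * exp (- t) ^ card D"
      by (simp add: algebra_simps flip: exp_of_nat_mult exp_add)
    finally show "1 \<le> exp (t * c) * exp (- t) ^ card D" .
  qed
  also have "\<dots> \<le> (\<Sum>D\<in>Pow V. exp (t * c) * exp (- t) ^ card D)"
    by (rule sum_mono2) (use assms(1) in auto)
  also have "\<dots> = exp (t * c) * (\<Prod>v\<in>V. exp (- t) + 1)"
    by (subst prod_add[OF assms(1)]) (simp add: sum_distrib_left)
  finally show ?thesis
    by (simp add: add.commute)
qed

text \<open>
  A labelling is determined by its values on representatives of the orbits together with its
  disagreement set.
\<close>

lemma card_labellings_le:
  fixes f :: "'v \<Rightarrow> 'v" and c t :: real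
  assumes "finite V" "f permutes V" "R \<subseteq> V" "t \<ge> 0"
    and R: "\<And>v. v \<in> V \<Longrightarrow> \<exists>u\<in>R. \<exists>k. (f ^^ k) u = v"
  shows "real (card {x \<in> V \<rightarrow>\<^sub>E (UNIV :: bool set). real (card {v \<in> V. x v \<noteq> x (f v)}) \<le> c})
    \<le> 2 ^ card R * (exp (t * c) * (1 + exp (- t)) ^ card V)"
proof -
  let ?X = "{x \<in> V \<rightarrow>\<^sub>E (UNIV :: bool set). real (card {v \<in> V. x v \<noteq> x (f v)}) \<le> c}"
  let ?\<Phi> = "\<lambda>x. ({v \<in> R. x v}, {v \<in> V. x v \<noteq> x (f v)})"
  let ?Y = "Pow R \<times> {D \<in> Pow V. real (card D) \<le> c}"
  have "inj_on ?\<Phi> ?X"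
  proof (rule inj_onI)
    fix x y assume x: "x \<in> ?X" and y: "y \<in> ?X" and eq: "?\<Phi> x = ?\<Phi> y"
    have eq_R: "x v = y v" if "v \<in> R" for v
      using that eq by blast
    have eq_D: "(x v \<noteq> x (f v)) = (y v \<noteq> y (f v))" if "v \<in> V" for v
      using that eq by blast
    have "(f ^^ k) u \<in> V \<and> x ((f ^^ k) u) = y ((f ^^ k) u)" if "u \<in> R" for u k
    proof (induction k)
      case 0
      then show ?case
        using that eq_R assms(3) by auto
    next
      case (Suc k)
      then show ?case
        using eq_D[of "(f ^^ k) u"] permutes_in_image[OF assms(2), of "(f ^^ k) u"]
        by (simp only: funpow.simps comp_apply) blast
    qed
    then have "x v = y v" if "v \<in> V" for v
      using R[OF that] by blast
    then show "x = y"
      using x y by (blast intro: PiE_ext)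
  qed
  moreover have "finite R"
    using assms finite_subset by blast
  ultimately have "card ?X \<le> card ?Y"
    by (intro card_inj_on_le[of ?\<Phi>]) (use assms(1,3) in auto)
  also have "\<dots> = 2 ^ card R * card {D \<in> Pow V. real (card D) \<le> c}"
    using \<open>finite R\<close> by (simp add: card_cartesian_product card_Pow)
  finally have "real (card ?X) \<le> real (2 ^ card R * card {D \<in> Pow V. real (card D) \<le> c})"
    by (simp only: of_nat_le_iff)
  also have "\<dots> = 2 ^ card R * real (card {D \<in> Pow V. real (card D) \<le> c})"
    by simp
  also have "\<dots> \<le> 2 ^ card R * (exp (t * c) * (1 + exp (- t)) ^ card V)"
    by (intro mult_left_mono card_small_subsets_le assms) simp
  finally show ?thesis .
qed

section \<open>The energy-entropy inequality\<close>

lemma add_one_mult_ln_decreasing: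
  fixes a b :: real
  assumes "0 < a" "a < b"
  shows "(b + 1) * ln (1 + 1 / b) < (a + 1) * ln (1 + 1 / a)"
proof (rule DERIV_neg_imp_decreasing[OF assms(2)])
  fix x assume "a \<le> x" "x \<le> b"
  then have x: "x > 0" using assms by simp
  have "((\<lambda>x. (x + 1) * ln (1 + 1 / x)) has_real_derivative
      ln (1 + 1 / x) + (x + 1) * (- (1 / x\<^sup>2) / (1 + 1 / x))) (at x)"
    using x by (auto intro!: derivative_eq_intros simp: power2_eq_square add_pos_pos)
  moreover have "(x + 1) * (- (1 / x\<^sup>2) / (1 + 1 / x)) = - (1 / x)"
    using x by (simp add: divide_simps power2_eq_square)
  moreover have "ln (1 + 1 / x) < 1 / x"
    using x by (intro ln_add_one_self_less_self) simp
  ultimately show "\<exists>y. ((\<lambda>x. (x + 1) * ln (1 + 1 / x)) has_real_derivative y) (at x) \<and> y < 0"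
    by (intro exI[of _ "ln (1 + 1 / x) - 1 / x"]) simp
qed

lemma exp_two_artanh:
  fixes y :: real
  assumes "\<bar>y\<bar> < 1"
  shows "exp (2 * artanh y) = (1 + y) / (1 - y)"
  using assms by (simp add: artanh_def)

text \<open>Both thresholds are used only through the lower bounds that they give for \<open>e\<^sup>2\<^sup>J\<close>.\<close>

lemma exp_ge_of_J_uniq:
  assumes "r \<ge> 2" "J \<ge> 2 * J_uniq r"
  shows "exp (2 * J) \<ge> (real r / (real r - 1))\<^sup>2"
proof -
  have "(real r / (real r - 1))\<^sup>2 = exp (2 * ln (real r / (real r - 1)))"
    using assms(1) by (subst exp_double) simp
  also have "\<dots> \<le> exp (2 * J)"
    using assms by (simp add: two_J_uniq_eq)
  finally show ?thesis .
qed

text \<open>For rank at least 3 the threshold \<open>J_rec\<close> is at least \<open>2 J_uniq\<close>, so it yields the same bound.\<close>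

lemma exp_ge_of_J_rec:
  assumes "r \<ge> 3" "J \<ge> J_rec r"
  shows "exp (2 * J) \<ge> (real r / (real r - 1))\<^sup>2"
proof -
  \<comment> \<open>In terms of \<open>q = 2 r - 1\<close> the claim is \<open>q powr (-1/2) \<ge> 2 q / (q\<^sup>2 + 1)\<close>, that is, \<open>4 q\<^sup>3 \<le> (q\<^sup>2 + 1)\<^sup>2\<close>;
    this holds for \<open>q \<ge> 4\<close> but fails for \<open>q = 3\<close>.\<close>
  define q where "q = 2 * real r - 1"
  define y where "y = q powr (- 1 / 2)"
  have q: "q \<ge> 5"
    using assms(1) by (simp add: q_def)
  have y: "y = 1 / sqrt q"
    using q by (simp add: y_def powr_minus_divide powr_half_sqrt flip: minus_divide_left)
  have y1: "0 < y" "y < 1"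
    using q by (simp_all add: y)
  have "2 * q / (q\<^sup>2 + 1) \<le> y"
  proof -
    have "(2 * q * sqrt q)\<^sup>2 \<le> (q\<^sup>2 + 1)\<^sup>2"
    proof -
      have "(2 * q * sqrt q)\<^sup>2 = 4 * q ^ 3"
        using q by (simp add: power_mult_distrib) (simp add: power2_eq_square power3_eq_cube)
      also have "\<dots> \<le> 4 * q ^ 3 + (q ^ 3 * (q - 4) + 2 * q\<^sup>2 + 1)"
        using q by (intro le_add_same_cancel1[THEN iffD2] add_nonneg_nonneg mult_nonneg_nonneg) auto
      also have "\<dots> = (q\<^sup>2 + 1)\<^sup>2"
        by (simp add: power2_eq_square power3_eq_cube algebra_simps)
      finally show ?thesis .
    qed
    then have "2 * q * sqrt q \<le> q\<^sup>2 + 1"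
      by (rule power2_le_imp_le) simp
    then show ?thesis
      using q by (simp add: y divide_simps add_pos_nonneg)
  qed
  then have "(1 + 2 * q / (q\<^sup>2 + 1)) / (1 - 2 * q / (q\<^sup>2 + 1)) \<le> (1 + y) / (1 - y)"
    using q y1 by (intro frac_le) auto
  also have "(1 + 2 * q / (q\<^sup>2 + 1)) / (1 - 2 * q / (q\<^sup>2 + 1)) = (real r / (real r - 1))\<^sup>2"
  proof -
    have pos: "q\<^sup>2 + 1 > 0"
      by (simp add: add_nonneg_pos)
    have "(1 + 2 * q / (q\<^sup>2 + 1)) / (1 - 2 * q / (q\<^sup>2 + 1))
        = ((q + 1)\<^sup>2 / (q\<^sup>2 + 1)) / ((q - 1)\<^sup>2 / (q\<^sup>2 + 1))"
      using pos by (intro arg_cong2[of _ _ _ _ "(/)"]) (simp_all add: field_simps power2_eq_square)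
    also have "\<dots> = ((q + 1) / (q - 1))\<^sup>2"
      using pos by (simp add: power_divide)
    also have "(q + 1) / (q - 1) = real r / (real r - 1)"
      using assms(1) by (simp add: q_def divide_simps)
    finally show ?thesis .
  qed
  also have "(1 + y) / (1 - y) = exp (2 * J_rec r)"
    using y1 unfolding J_rec_def q_def[symmetric] y_def[symmetric] by (simp add: exp_two_artanh)
  also have "\<dots> \<le> exp (2 * J)"
    using assms(2) by simp
  finally show ?thesis .
qed

lemma exp_ge_of_J_rec_2:
  assumes "J \<ge> J_rec 2"
  shows "exp (2 * J) \<ge> 7 / 2"
proof -
  have y: "(3 :: real) powr (- 1 / 2) = 1 / sqrt 3"
    by (simp add: powr_minus_divide powr_half_sqrt flip: minus_divide_left)
  have J: "J_rec 2 = artanh (1 / sqrt 3)"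
    using y by (simp add: J_rec_def)
  \<comment> \<open>The value 5/9 is a rational lower bound for \<open>1 / sqrt 3\<close>.\<close>
  have "sqrt 3 \<le> 9 / (5 :: real)"
    by (rule real_le_lsqrt) (simp_all add: power2_eq_square)
  then have s: "5 / 9 \<le> 1 / sqrt (3 :: real)"
    by (simp add: divide_simps)
  have "(7 / 2 :: real) = (1 + 5 / 9) / (1 - 5 / 9)"
    by simp
  also have "\<dots> \<le> (1 + 1 / sqrt 3) / (1 - 1 / sqrt 3)"
    using s by (intro frac_le) auto
  also have "\<dots> = exp (2 * J_rec 2)"
    by (simp add: exp_two_artanh J)
  also have "\<dots> \<le> exp (2 * J)"
    using assms by simp
  finally show ?thesis .
qed

text \<open>
  With \<open>p = 1 / (e\<^sup>2\<^sup>J + 1)\<close>, the upper bound \<open>2 J p + ln (1 + e\<^sup>-\<^sup>2\<^sup>J)\<close> for the entropy is smaller than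
  the energy excess \<open>2 J p r\<close> over the all-plus configuration. The term \<open>2 J p\<close> is cancelled and
  both sides are divided by \<open>p\<close>.
\<close>

lemma energy_entropy_inequality:
  fixes J :: real
  assumes "r \<ge> 2" "J > 0" "J \<ge> 2 * J_uniq r \<or> J \<ge> J_rec r"
  shows "(exp (2 * J) + 1) * ln (1 + exp (- 2 * J)) < 2 * J * (real r - 1)"
proof -
  define a where "a = exp (2 * J)"
  have a: "a > 1" and ln_a: "ln a = 2 * J" and inv_a: "exp (- 2 * J) = 1 / a"
    using assms(2) by (simp_all add: a_def exp_minus field_simps)
  consider "a \<ge> (real r / (real r - 1))\<^sup>2" | "r = 2" "a \<ge> 7 / 2"
    using assms exp_ge_of_J_uniq[of r J] exp_ge_of_J_rec[of r J] exp_ge_of_J_rec_2[of J]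
    unfolding a_def by (cases "r = 2") auto
  then have "(a + 1) * ln (1 + 1 / a) < ln a * (real r - 1)"
  proof cases
    case 1
    define m where "m = r - 1"
    have m: "m \<ge> 1" "real r = real m + 1"
      using assms(1) by (auto simp: m_def)
    have "(a + 1) * ln (1 + 1 / a) < 2 * ln 2"
      using add_one_mult_ln_decreasing[OF _ a] by simp
    \<comment> \<open>Bernoulli's inequality bounds \<open>m ln (1 + 1/m)\<close> below by \<open>ln 2\<close>.\<close>
    also have "2 \<le> (1 + 1 / real m) ^ m"
      using Bernoulli_inequality[of "1 / real m" m] m by (simp add: order_trans[of "-1" 0])
    then have "ln 2 \<le> ln ((1 + 1 / real m) ^ m)"
      by (subst ln_le_cancel_iff) auto
    then have "2 * ln 2 \<le> 2 * (real m * ln (1 + 1 / real m))"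
      by (simp add: ln_realpow)
    also have "\<dots> = ln ((real r / (real r - 1))\<^sup>2) * (real r - 1)"
      using m by (simp add: ln_realpow add_divide_distrib)
    also have "\<dots> \<le> ln a * (real r - 1)"
      using 1 m a by (intro mult_right_mono, subst ln_le_cancel_iff) (auto intro!: zero_less_power)
    finally show ?thesis .
  next
    case 2
    have "(a + 1) * ln (1 + 1 / a) \<le> (b + 1) * ln (1 + 1 / b)" if "b = 7 / 2" for b :: real
      using 2(2) that add_one_mult_ln_decreasing[of b a] by (cases "a = b") auto
    from this[OF refl] have "(a + 1) * ln (1 + 1 / a) \<le> (7 / 2 + 1) * ln (1 + 1 / (7 / 2))" .
    also have "\<dots> = ln ((9 / 7) ^ 9) / 2"
      by (simp add: ln_realpow)
    also have "\<dots> < ln ((7 / 2)\<^sup>2) / 2"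
      by (intro divide_strict_right_mono, subst ln_less_cancel_iff) (simp_all add: power_divide)
    also have "\<dots> = ln (7 / 2)"
      by (simp add: ln_realpow)
    also have "\<dots> \<le> ln a"
      using 2(2) by (subst ln_le_cancel_iff) auto
    finally show ?thesis
      using 2(1) by simp
  qed
  then show ?thesis
    by (simp add: ln_a flip: inv_a) (simp add: a_def)
qed

section \<open>Powers of a generator and the disagreement observable\<close>

lemma word_of_gen_power: "word_of (gen i ^ k) = replicate k (i, True)"
proof (induction k)
  case (Suc k)
  have "word_of (gen i * g) = mult_letter (i, True) (word_of g)" for g :: "'a free_group"
    by transfer (simp add: mult_word_Cons)
  then have "word_of (gen i ^ Suc k) = mult_letter (i, True) (replicate k (i, True))"
    by (simp add: Suc.IH)
  then show ?case
    by (cases k) (simp_all add: mult_letter_def inv_letter_def del: power_Suc)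
qed (simp add: one_free_group.rep_eq)

lemma gen_power_neq_1: "k > 0 \<Longrightarrow> gen i ^ k \<noteq> 1"
  using word_of_gen_power[of i k] by (metis one_free_group.rep_eq length_replicate list.size(3) less_irrefl)

lemma gen_mult_inverse: "gen i * inverse (gen i) = 1"
  by transfer (simp add: mult_word_def inv_word_def mult_letter_def)

text \<open>
  The indicator function of the event that the spins at two vertices disagree. It is continuous,
  so bounds on its integral define weak-star open sets.
\<close>

definition disagreement :: "'s free_group \<Rightarrow> 's free_group \<Rightarrow> 's config \<Rightarrow> real" where
  "disagreement g h x = (if x g \<noteq> x h then 1 else 0)"

lemma spin_product_eq: "spin_value (x g) * spin_value (x h) = 1 - 2 * disagreement g h x"
  by (auto simp: spin_value_def disagreement_def)

lemma continuous_on_disagreement: "continuous_on UNIV (disagreement g h)"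
proof -
  have spin: "continuous_on UNIV (\<lambda>x :: 's config. spin_value (x g))" for g
    by (rule continuous_on_compose2[OF Topological_Spaces.continuous_on_discrete[of UNIV]
          continuous_on_product_coordinates]) simp
  have "disagreement g h = (\<lambda>x. (1 - spin_value (x g) * spin_value (x h)) / 2)"
    by (simp add: spin_product_eq fun_eq_iff)
  then show ?thesis
    by (simp only:) (intro continuous_intros spin, simp)
qed

lemma disagreement_borel [measurable]: "disagreement g h \<in> borel_measurable borel"
  by (intro borel_measurable_continuous_onI continuous_on_disagreement)

lemma integral_disagreement_empirical:
  assumes "finite V" "V \<noteq> {}"
  shows "(\<integral>y. disagreement g h y \<partial>empirical_distribution V \<sigma> x)
    = real (card {v \<in> V. x (\<sigma> g v) \<noteq> x (\<sigma> h v)}) / real (card V)"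
proof -
  have "(\<integral>y. disagreement g h y \<partial>empirical_distribution V \<sigma> x)
      = (\<integral>v. disagreement g h (pullback \<sigma> v x) \<partial>uniform_count_measure V)"
    unfolding empirical_distribution_def
    by (intro integral_distr disagreement_borel)
      (simp add: measurable_def space_uniform_count_measure sets_uniform_count_measure)
  also have "\<dots> = (\<Sum>v\<in>V. disagreement g h (pullback \<sigma> v x)) / real (card V)"
    by (rule integral_uniform_count_measure[OF assms(1)])
  also have "(\<Sum>v\<in>V. disagreement g h (pullback \<sigma> v x)) = real (card {v \<in> V. x (\<sigma> g v) \<noteq> x (\<sigma> h v)})"
    using assms(1) by (simp add: disagreement_def pullback_def sum.If_cases Int_def)
  finally show ?thesis .
qed

section \<open>An upper bound for sofic entropy\<close>

text \<open>
  In a sofic map almost all points are fixed by the identity element, which need not act as the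
  identity permutation, and lie on long cycles of the permutation of a generator.
\<close>

lemma sofic_map_generator:
  assumes "finite V" "V \<noteq> {}" "\<And>g. \<sigma> g permutes V" "L \<ge> 1"
    and sofic: "sofic_map V \<sigma> ((\<lambda>k. gen i ^ k) ` {..L}) \<delta>"
  shows "real (card {v \<in> V. \<sigma> 1 v \<noteq> v \<or> (\<exists>k\<in>{1..<L}. (\<sigma> (gen i) ^^ k) v = v)})
    \<le> 2 * \<delta> * real (card V)"
proof -
  let ?F = "(\<lambda>k. gen i ^ k) ` {..L}"
  let ?A = "{v \<in> V. \<forall>g\<in>?F - {1}. \<sigma> g v \<noteq> v}"
  let ?M = "{v \<in> V. \<forall>g\<in>?F. \<forall>h\<in>?F. \<sigma> (g * h) v = \<sigma> g (\<sigma> h v)}"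
  let ?B = "{v \<in> V. \<sigma> 1 v \<noteq> v \<or> (\<exists>k\<in>{1..<L}. (\<sigma> (gen i) ^^ k) v = v)}"
  have in_F: "gen i ^ k \<in> ?F" if "k \<le> L" for k
    using that by blast
  have "?B \<subseteq> (V - ?A) \<union> (V - ?M)"
  proof
    fix v assume v: "v \<in> ?B"
    have False if "v \<in> ?A" "v \<in> ?M"
    proof -
      have mult: "\<sigma> (g * h) v = \<sigma> g (\<sigma> h v)" if "g \<in> ?F" "h \<in> ?F" for g h
        using \<open>v \<in> ?M\<close> that by blast
      have "\<sigma> 1 (\<sigma> 1 v) = \<sigma> 1 v"
        using mult[of 1 1] in_F[of 0] by simp
      then have one: "\<sigma> 1 v = v"
        by (rule injD[OF permutes_inj[OF assms(3)]])
      have pow: "\<sigma> (gen i ^ k) v = (\<sigma> (gen i) ^^ k) v" if "k \<le> L" for k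
        using that
      proof (induction k)
        case (Suc k)
        then show ?case
          using mult[OF in_F[of 1] in_F[of k]] assms(4) by simp
      qed (simp add: one)
      have "(\<sigma> (gen i) ^^ k) v \<noteq> v" if "k \<in> {1..<L}" for k
        using that pow[of k] in_F[of k] gen_power_neq_1[of k i] \<open>v \<in> ?A\<close> by auto
      then show False
        using v one by blast
    qed
    then show "v \<in> (V - ?A) \<union> (V - ?M)"
      using v by blast
  qed
  then have "card ?B \<le> card ((V - ?A) \<union> (V - ?M))"
    by (intro card_mono) (use assms(1) in auto)
  also have "\<dots> \<le> card (V - ?A) + card (V - ?M)"
    by (rule card_Un_le)
  finally have "real (card ?B) \<le> real (card (V - ?A)) + real (card (V - ?M))"
    by linarith
  also have "real (card (V - S)) \<le> \<delta> * real (card V)"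
    if "S \<subseteq> V" "real (card S) / real (card V) > 1 - \<delta>" for S
  proof -
    have "card V > 0"
      using assms(1,2) by (simp add: card_gt_0_iff)
    then have "(1 - \<delta>) * real (card V) < real (card S)"
      using that(2) by (simp add: field_simps)
    moreover have "real (card (V - S)) = real (card V) - real (card S)"
      using that(1) assms(1) by (simp add: card_Diff_subset finite_subset card_mono of_nat_diff)
    ultimately show ?thesis
      by (simp add: algebra_simps)
  qed
  note le = this
  have "real (card (V - ?A)) + real (card (V - ?M)) \<le> \<delta> * real (card V) + \<delta> * real (card V)"
    by (intro add_mono le) (use sofic in \<open>auto simp: sofic_map_def\<close>)
  finally show ?thesis
    by simp
qed

text \<open>
  The error term in \<open>\<eta>\<close> accounts for the non-sofic points, which spoil up to \<open>2 \<eta> n\<close> disagreements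
  and, together with the long cycles, require up to \<open>3 \<eta> n\<close> representatives.
\<close>

lemma card_good_models_le:
  fixes \<sigma> :: "'s free_group \<Rightarrow> 'v \<Rightarrow> 'v" and t c \<eta> :: real
  assumes "finite V" "V \<noteq> {}" "\<And>g. \<sigma> g permutes V" "L \<ge> 1" "1 / real L \<le> \<eta>" "t \<ge> 0"
    and sofic: "sofic_map V \<sigma> ((\<lambda>k. gen i ^ k) ` {..L}) \<eta>"
    and \<O>: "\<And>\<mu>. \<mu> \<in> \<O> \<Longrightarrow> (\<integral>x. disagreement 1 (gen i) x \<partial>\<mu>) < c"
  shows "ereal (1 / real (card V)) * log_card (good_models V \<sigma> \<O>)
    \<le> ereal (t * c + ln (1 + exp (- t)) + \<eta> * (2 * t + 3 * ln 2))"
proof -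
  let ?f = "\<sigma> (gen i)" and ?n = "real (card V)" and ?G = "good_models V \<sigma> \<O>"
  let ?B = "{v \<in> V. \<sigma> 1 v \<noteq> v \<or> (\<exists>k\<in>{1..<L}. (?f ^^ k) v = v)}"
  let ?B' = "{v \<in> V. \<exists>k\<in>{1..<L}. (?f ^^ k) v = v}"
  let ?C = "(c + 2 * \<eta>) * ?n"
  have n: "?n > 0"
    using assms(1,2) by (simp add: card_gt_0_iff)
  have B: "real (card ?B) \<le> 2 * \<eta> * ?n"
    by (rule sofic_map_generator[OF assms(1-4) sofic])
  obtain R where R: "R \<subseteq> V" "\<And>v. v \<in> V \<Longrightarrow> \<exists>u\<in>R. \<exists>k. (?f ^^ k) u = v"
    "L * card (R - ?B') \<le> card V"
    by (rule orbit_representatives[OF assms(1) assms(3)[of "gen i"], of L]) blast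
  have "real (card R) \<le> 3 * \<eta> * ?n"
  proof -
    have "card R \<le> card ((R - ?B') \<union> ?B)"
      by (intro card_mono) (use assms(1) R(1) finite_subset[of R V] in auto)
    also have "\<dots> \<le> card (R - ?B') + card ?B"
      by (rule card_Un_le)
    finally have "real (card R) \<le> real (card (R - ?B')) + real (card ?B)"
      by linarith
    also have "real (card (R - ?B')) \<le> \<eta> * ?n"
    proof -
      have "real L * real (card (R - ?B')) \<le> ?n"
        using of_nat_mono[OF R(3), where 'a = real] by simp
      then have "real (card (R - ?B')) \<le> 1 / real L * ?n"
        using assms(4) by (simp add: field_simps)
      also have "\<dots> \<le> \<eta> * ?n"
        using assms(5) by (intro mult_right_mono) auto
      finally show ?thesis .
    qed
    finally show ?thesis
      using B by linarith
  qed
  then have "real (card R) * ln 2 \<le> 3 * \<eta> * ?n * ln 2"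
    by (intro mult_right_mono) auto
  then have "exp (real (card R) * ln 2) \<le> exp (3 * \<eta> * ?n * ln 2)"
    by (simp only: exp_le_cancel_iff)
  then have R_le: "(2 :: real) ^ card R \<le> exp (3 * \<eta> * ?n * ln 2)"
    by (simp only: exp_of_nat_mult exp_ln[of 2] zero_less_numeral)
  have "?G \<subseteq> {x \<in> V \<rightarrow>\<^sub>E (UNIV :: bool set). real (card {v \<in> V. x v \<noteq> x (?f v)}) \<le> ?C}"
  proof
    fix x assume x: "x \<in> ?G"
    have "real (card {v \<in> V. x (\<sigma> 1 v) \<noteq> x (?f v)}) / ?n < c"
      using \<O>[of "empirical_distribution V \<sigma> x"] x
        integral_disagreement_empirical[OF assms(1,2), of \<sigma> x 1 "gen i"]
      by (simp add: good_models_def)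
    then have 1: "real (card {v \<in> V. x (\<sigma> 1 v) \<noteq> x (?f v)}) \<le> c * ?n"
      using n by (simp add: field_simps)
    have "card {v \<in> V. x v \<noteq> x (?f v)} \<le> card ({v \<in> V. x (\<sigma> 1 v) \<noteq> x (?f v)} \<union> ?B)"
      by (intro card_mono) (use assms(1) in auto)
    also have "\<dots> \<le> card {v \<in> V. x (\<sigma> 1 v) \<noteq> x (?f v)} + card ?B"
      by (rule card_Un_le)
    finally have "real (card {v \<in> V. x v \<noteq> x (?f v)}) \<le> c * ?n + 2 * \<eta> * ?n"
      using 1 B by linarith
    then show "x \<in> {x \<in> V \<rightarrow>\<^sub>E UNIV. real (card {v \<in> V. x v \<noteq> x (?f v)}) \<le> ?C}"
      using x by (simp add: good_models_def algebra_simps)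
  qed
  moreover have "finite {x \<in> V \<rightarrow>\<^sub>E (UNIV :: bool set). real (card {v \<in> V. x v \<noteq> x (?f v)}) \<le> ?C}"
    by (rule finite_subset[OF _ finite_PiE[OF assms(1)]]) auto
  ultimately have "card ?G \<le> card {x \<in> V \<rightarrow>\<^sub>E (UNIV :: bool set). real (card {v \<in> V. x v \<noteq> x (?f v)}) \<le> ?C}"
    by (rule card_mono[rotated])
  then have "real (card ?G) \<le> 2 ^ card R * (exp (t * ?C) * (1 + exp (- t)) ^ card V)"
    using card_labellings_le[OF assms(1) assms(3)[of "gen i"] R(1) assms(6) R(2), of ?C] by linarith
  also have "\<dots> \<le> exp (3 * \<eta> * ?n * ln 2) * (exp (t * ?C) * (1 + exp (- t)) ^ card V)"
    by (intro mult_right_mono R_le) (auto intro!: add_nonneg_nonneg)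
  also have "(1 + exp (- t)) ^ card V = exp (?n * ln (1 + exp (- t)))"
    by (simp add: exp_of_nat_mult add_pos_pos)
  finally have le: "real (card ?G) \<le>
      exp (?n * (t * c + ln (1 + exp (- t)) + \<eta> * (2 * t + 3 * ln 2)))"
    by (simp add: algebra_simps flip: exp_add)
  show ?thesis
  proof (cases "card ?G = 0")
    case True
    then show ?thesis
      using n by (simp add: log_card_def)
  next
    case False
    then have "ln (real (card ?G))
        \<le> ln (exp (?n * (t * c + ln (1 + exp (- t)) + \<eta> * (2 * t + 3 * ln 2))))"
      using le by (subst ln_le_cancel_iff) auto
    then have "ln (real (card ?G)) / ?n \<le> t * c + ln (1 + exp (- t)) + \<eta> * (2 * t + 3 * ln 2)"
      using n by (simp only: ln_exp divide_le_eq mult.commute if_True)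
    then show ?thesis
      using False by (simp add: log_card_def)
  qed
qed

text \<open>
  For \<open>0 < p < 1/2\<close>, where \<open>p\<close> is the disagreement probability, the choice \<open>t = ln ((1 - p) / p)\<close>
  turns the bound into the Shannon entropy of a spin with bias \<open>p\<close>.
\<close>

lemma sofic_entropy_le:
  fixes \<sigma> :: "nat \<Rightarrow> 's free_group \<Rightarrow> 'v \<Rightarrow> 'v" and t :: real
  assumes "sofic_approximation V \<sigma>" "\<mu> \<in> borel_probs" "t \<ge> 0"
  shows "sofic_entropy V \<sigma> \<mu>
    \<le> ereal (t * (\<integral>x. disagreement 1 (gen i) x \<partial>\<mu>) + ln (1 + exp (- t)))"
proof (rule ereal_le_epsilon2)
  let ?p = "\<integral>x. disagreement 1 (gen i) x \<partial>\<mu>"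
  fix e :: real assume "e > 0"
  show "sofic_entropy V \<sigma> \<mu> \<le> ereal (t * ?p + ln (1 + exp (- t))) + ereal e"
  proof -
    \<comment> \<open>One \<open>t\<close> pays for the width \<open>\<eta>\<close> of the neighbourhood, \<open>2 t + 3 ln 2\<close> for the error term.\<close>
    define \<eta> where "\<eta> = e / (3 * t + 3 * ln 2)"
    have pos: "3 * t + 3 * ln 2 > 0"
      using assms(3) by (intro add_nonneg_pos) auto
    then have \<eta>: "\<eta> > 0" "\<eta> * (3 * t + 3 * ln 2) = e"
      using \<open>e > 0\<close> by (simp_all add: \<eta>_def)
    obtain L where L: "L \<ge> 1" "1 / real L \<le> \<eta>"
    proof -
      obtain m where "inverse (real (Suc m)) < \<eta>"
        using reals_Archimedean[OF \<eta>(1)] by blast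
      then show ?thesis
        by (intro that[of "Suc m"]) (simp_all add: inverse_eq_divide)
    qed
    let ?\<O> = "{\<nu> \<in> borel_probs. (\<integral>x. disagreement 1 (gen i) x \<partial>\<nu>) \<in> {..<?p + \<eta>}}"
    have "openin weak_star ?\<O>"
      unfolding weak_star_def
      by (rule topology_generated_by_Basis) (use continuous_on_disagreement open_lessThan in blast)
    moreover have "\<mu> \<in> ?\<O>"
      using assms(2) \<eta>(1) by simp
    ultimately have "sofic_entropy V \<sigma> \<mu>
        \<le> limsup (\<lambda>n. ereal (1 / real (card (V n))) * log_card (good_models (V n) (\<sigma> n) ?\<O>))"
      unfolding sofic_entropy_def by (intro INF_lower) blast
    also have "\<dots> \<le> ereal (t * (?p + \<eta>) + ln (1 + exp (- t)) + \<eta> * (2 * t + 3 * ln 2))"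
    proof (rule Limsup_bounded)
      have "\<forall>\<^sub>F n in sequentially. card (V n) \<ge> 1"
        using assms(1) unfolding sofic_approximation_def filterlim_at_top by blast
      moreover have "\<forall>\<^sub>F n in sequentially. sofic_map (V n) (\<sigma> n) ((\<lambda>k. gen i ^ k) ` {..L}) \<eta>"
        using assms(1) \<eta>(1) unfolding sofic_approximation_def by blast
      ultimately show "\<forall>\<^sub>F n in sequentially.
          ereal (1 / real (card (V n))) * log_card (good_models (V n) (\<sigma> n) ?\<O>)
          \<le> ereal (t * (?p + \<eta>) + ln (1 + exp (- t)) + \<eta> * (2 * t + 3 * ln 2))"
      proof eventually_elim
        case (elim n)
        show ?case
        proof (rule card_good_models_le[OF _ _ _ L assms(3) elim(2)])
          show "finite (V n)" "V n \<noteq> {}" "\<sigma> n g permutes V n" for g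
            using assms(1) elim(1) by (auto simp: sofic_approximation_def)
        qed simp
      qed
    qed
    also have "t * (?p + \<eta>) + ln (1 + exp (- t)) + \<eta> * (2 * t + 3 * ln 2)
        = t * ?p + ln (1 + exp (- t)) + e"
      by (simp add: algebra_simps flip: \<eta>(2))
    finally show "sofic_entropy V \<sigma> \<mu> \<le> ereal (t * ?p + ln (1 + exp (- t))) + ereal e"
      by simp
  qed
qed

section \<open>The pressure of the all-plus configuration\<close>

lemma plus_state_borel_probs: "return borel (\<lambda>_. True) \<in> borel_probs"
  by (auto simp: borel_probs_def intro: prob_space_return)

lemma shift_invariant_plus_state: "shift_invariant (return borel (\<lambda>_. True))"
  by (auto simp: shift_invariant_def shift_def distr_return[OF measurable_shift])

lemma sofic_entropy_plus_state_nonneg: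
  fixes \<sigma> :: "nat \<Rightarrow> 's free_group \<Rightarrow> 'v \<Rightarrow> 'v"
  assumes "sofic_approximation V \<sigma>"
  shows "0 \<le> sofic_entropy V \<sigma> (return borel (\<lambda>_. True))"
  unfolding sofic_entropy_def
proof (rule INF_greatest)
  fix \<O> :: "'s config measure set"
  assume \<O>: "\<O> \<in> {\<O>. openin weak_star \<O> \<and> return borel (\<lambda>_. True) \<in> \<O>}"
  have ev: "\<forall>\<^sub>F n in sequentially.
      0 \<le> ereal (1 / real (card (V n))) * log_card (good_models (V n) (\<sigma> n) \<O>)"
  proof -
    have "\<forall>\<^sub>F n in sequentially. card (V n) \<ge> 1"
      using assms unfolding sofic_approximation_def filterlim_at_top by blast
    then show ?thesis
    proof eventually_elim
      case (elim n)
      let ?x = "\<lambda>v\<in>V n. True"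
      have fin: "finite (V n)" "V n \<noteq> {}" and perm: "\<sigma> n g permutes V n" for g
        using assms elim by (auto simp: sofic_approximation_def)
      have "pullback (\<sigma> n) v ?x = (\<lambda>_. True)" if "v \<in> V n" for v
        using that permutes_in_image[OF perm] by (simp add: pullback_def)
      then have "empirical_distribution (V n) (\<sigma> n) ?x
          = distr (uniform_count_measure (V n)) borel (\<lambda>_. \<lambda>_. True)"
        unfolding empirical_distribution_def
        by (intro distr_cong) (simp_all add: space_uniform_count_measure)
      also have "\<dots> = return borel (\<lambda>_. True)"
        by (rule prob_space.distr_const[OF prob_space_uniform_count_measure[OF fin]]) simp
      finally have "?x \<in> good_models (V n) (\<sigma> n) \<O>"
        using \<O> by (simp add: good_models_def)
      moreover have "finite (good_models (V n) (\<sigma> n) \<O>)"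
        by (rule finite_subset[OF _ finite_PiE[OF fin(1)]]) (auto simp: good_models_def)
      ultimately have "card (good_models (V n) (\<sigma> n) \<O>) \<ge> 1"
        by (metis One_nat_def Suc_leI card_gt_0_iff empty_iff)
      then show ?case
        by (auto simp: log_card_def intro!: ereal_0_le_mult)
    qed
  qed
  show "0 \<le> limsup (\<lambda>n. ereal (1 / real (card (V n))) * log_card (good_models (V n) (\<sigma> n) \<O>))"
    by (rule le_Limsup[OF _ ev]) simp
qed

lemma ising_energy_borel: "ising_energy J \<in> borel_measurable borel"
  unfolding ising_energy_def[abs_def] spin_product_eq by measurable

lemma mean_energy_plus_state:
  "mean_energy J (return borel (\<lambda>_ :: 's::finite free_group. True)) = - J * real CARD('s)"
  unfolding mean_energy_def
  by (subst integral_return) (simp_all add: ising_energy_borel ising_energy_def spin_value_def)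

section \<open>The energy of the free boundary state\<close>

lemma integral_disagreement_free_boundary:
  fixes \<mu> :: "'s config measure"
  assumes "free_boundary_state J \<mu>" "cayley_adj g h"
  shows "(\<integral>x. disagreement g h x \<partial>\<mu>) = 1 / (exp (2 * J) + 1)"
proof -
  have \<mu>: "prob_space \<mu>" "sets \<mu> = sets borel"
    and half: "\<P>(x in \<mu>. x g = a) = 1 / 2"
    and trans: "\<P>(x in \<mu>. x h = b \<bar> x g = a) = ising_transition J a b" for a b
    using assms by (auto simp: free_boundary_state_def borel_probs_def)
  interpret prob_space \<mu> by (rule \<mu>)
  have space: "space \<mu> = UNIV"
    using sets_eq_imp_space_eq[OF \<mu>(2)] by simp
  have cyl: "{x. x w = a} \<in> sets \<mu>" for w a
    using cylinder_borel by (simp add: \<mu>(2))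
  let ?A = "\<lambda>a. {x \<in> space \<mu>. x h = (\<not> a) \<and> x g = a}"
  have sets_A: "?A a \<in> sets \<mu>" for a
    using sets.Int[OF cyl[of h "\<not> a"] cyl[of g a]] by (simp add: space Int_def)
  have prob_A: "prob (?A a) = 1 / (exp (2 * J) + 1) / 2" for a
  proof -
    have "prob (?A a) * 2 = 1 / (exp (2 * J) + 1)"
      using trans[of "\<not> a" a] half[of a] by (simp add: cond_prob_def ising_transition_def)
    then show ?thesis
      by (rule eq_divide_imp[rotated]) simp
  qed
  have "disagreement g h x = indicator (?A True \<union> ?A False) x" for x
    by (auto simp: disagreement_def indicator_def space)
  then have "(\<integral>x. disagreement g h x \<partial>\<mu>) = prob (?A True \<union> ?A False)"
    using sets_A by (simp add: space)
  also have "\<dots> = prob (?A True) + prob (?A False)"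
    using sets_A[of True] sets_A[of False] by (intro finite_measure_Union) auto
  finally show ?thesis
    by (simp only: prob_A)
qed

lemma mean_energy_free_boundary:
  fixes \<mu> :: "'s::finite config measure"
  assumes "free_boundary_state J \<mu>"
  shows "mean_energy J \<mu> = - J * real CARD('s) * (1 - 2 / (exp (2 * J) + 1))"
proof -
  have \<mu>: "prob_space \<mu>" "sets \<mu> = sets borel"
    using assms by (auto simp: free_boundary_state_def borel_probs_def)
  interpret prob_space \<mu> by (rule \<mu>)
  have int: "integrable \<mu> (disagreement g h)" for g h
    by (rule integrable_const_bound[of _ 1])
      (simp_all add: measurable_cong_sets[OF \<mu>(2) refl] disagreement_borel, simp add: disagreement_def)
  have adj: "cayley_adj 1 (gen i)" "cayley_adj 1 (inverse (gen i))" for i :: 's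
    using gen_mult_inverse[of i] by (metis cayley_adj_def mult.right_neutral)+
  have "mean_energy J \<mu> = - (J / 2) * (\<Sum>i\<in>UNIV. (1 - 2 * (\<integral>x. disagreement 1 (gen i) x \<partial>\<mu>))
      + (1 - 2 * (\<integral>x. disagreement 1 (inverse (gen i)) x \<partial>\<mu>)))"
    unfolding mean_energy_def ising_energy_def spin_product_eq
    by (simp add: int prob_space del: sum.distrib)
  then show ?thesis
    by (simp add: integral_disagreement_free_boundary[OF assms] adj)
qed

section \<open>The free boundary state at low temperature\<close>

theorem theorem2:
  fixes r :: nat and J :: real
    and V :: "nat \<Rightarrow> 'v set"
    and \<sigma> :: "nat \<Rightarrow> 's::finite free_group \<Rightarrow> 'v \<Rightarrow> 'v"
    and \<mu>FB :: "'s config measure"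
  assumes "r = CARD('s)" and "r \<ge> 2" and "J > 0"
    and "J \<ge> 2 * J_uniq r \<or> J \<ge> J_rec r"
    and "sofic_approximation V \<sigma>"
    and "free_boundary_state J \<mu>FB"
  shows "\<not> equilibrium V \<sigma> J \<mu>FB"
proof
  assume eq: "equilibrium V \<sigma> J \<mu>FB"
  define p where "p = 1 / (exp (2 * J) + 1)"
  let ?\<delta> = "return borel (\<lambda>_ :: 's free_group. True)"
  obtain i :: 's where True
    by blast
  have pos: "exp (2 * J) + 1 > 0"
    by (simp add: add_pos_pos)
  have "ereal (J * real r) \<le> sofic_entropy V \<sigma> ?\<delta> - ereal (mean_energy J ?\<delta>)"
    using ereal_minus_mono[OF sofic_entropy_plus_state_nonneg[OF assms(5)], of "ereal (mean_energy J ?\<delta>)" "ereal (mean_energy J ?\<delta>)"]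
    by (simp add: mean_energy_plus_state assms(1))
  also have "\<dots> \<le> sofic_entropy V \<sigma> \<mu>FB - ereal (mean_energy J \<mu>FB)"
    using eq plus_state_borel_probs shift_invariant_plus_state
    unfolding equilibrium_def pressure_def by blast
  also have "\<dots> \<le> ereal (2 * J * p + ln (1 + exp (- (2 * J)))) - ereal (- J * real r * (1 - 2 * p))"
  proof (rule ereal_minus_mono)
    \<comment> \<open>The parameter \<open>t = 2 J\<close> equals \<open>ln ((1 - p) / p)\<close>, which optimizes the entropy bound.\<close>
    have "cayley_adj 1 (gen i)"
      by (auto simp: cayley_adj_def)
    then show "sofic_entropy V \<sigma> \<mu>FB \<le> ereal (2 * J * p + ln (1 + exp (- (2 * J))))"
      using sofic_entropy_le[OF assms(5), of \<mu>FB "2 * J" i] assms(3,6)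
        integral_disagreement_free_boundary[OF assms(6), of 1 "gen i"]
      by (simp add: p_def free_boundary_state_def)
    show "ereal (- J * real r * (1 - 2 * p)) \<le> ereal (mean_energy J \<mu>FB)"
      using mean_energy_free_boundary[OF assms(6)] by (simp add: p_def assms(1))
  qed
  finally have "2 * J * p * (real r - 1) \<le> ln (1 + exp (- 2 * J))"
    by (simp add: algebra_simps)
  moreover have "ln (1 + exp (- 2 * J)) < 2 * J * p * (real r - 1)"
    using energy_entropy_inequality[OF assms(2-4)] pos by (simp add: p_def field_simps)
  ultimately show False
    by simp
qed

end
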